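(* Let $\ell_1=\ell_2=1$. The functions $H,p_1,p_2,G$ on $T^*{\mathcal C}$, where $$H=\frac12\left[(p_1-\eta_1\sin\alpha_1-\eta_2\sin\alpha_2)^2+(p_2+\eta_1\cos\alpha_1+\eta_2\cos\alpha_2)^2\right],$$ $$G=p_1(p_1-\eta_1\sin\alpha_1-\eta_2\sin\alpha_2)+p_2(p_2+\eta_1\cos\alpha_1+\eta_2\cos\alpha_2)+\frac12(\eta_1+\eta_2)^2,$$ pairwise Poisson commute, and they are almost everywhere functionally independent.
   Context: ${\mathcal C}=\{(x_1,x_2,\alpha_1,\alpha_2)\in\mathbb{R}^2\times T^2:\alpha_1\ne\alpha_2\}$ is the configuration space of 2-linkages $x,m_1,m_2$ with $x=(x_1,x_2)$, $m_i=x-(\cos\alpha_i,\sin\alpha_i)$. On $T^*{\mathcal C}$ use coordinates $(x_1,x_2,\alpha_1,\alpha_2,p_1,p_2,\eta_1,\eta_2)$, the last four being fiber coordinates conjugate to the first four, with the standard symplectic form $dx_1\wedge dp_1+dx_2\wedge dp_2+d\alpha_1\wedge d\eta_1+d\alpha_2\wedge d\eta_2$ and the corresponding Poisson bracket. Functionally independent almost everywhere means that their differentials are linearly independent at almost every point. ($H$ is the Hamiltonian of the sub-Riemannian geodesic flow of the linkage.) *)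

theory Defs
  imports "HOL-Analysis.Analysis"
begin

text \<open>The circle \<open>T\<^sup>1 = \<real>/2\<pi>\<int>\<close>.\<close>

definition angle_rel :: "real \<Rightarrow> real \<Rightarrow> bool" where
  "angle_rel a b \<longleftrightarrow> (\<exists>k::int. a - b = 2 * pi * of_int k)"

lemma equivp_angle_rel: "equivp angle_rel"
proof (rule equivpI)
  show "reflp angle_rel"
    by (auto simp: reflp_def angle_rel_def intro!: exI[of _ "0::int"])
  show "symp angle_rel"
  proof (rule sympI)
    fix a b assume "angle_rel a b"
    then obtain k :: int where "a - b = 2 * pi * of_int k"
      unfolding angle_rel_def by blast
    then have "b - a = 2 * pi * of_int (- k)" by simp
    then show "angle_rel b a" unfolding angle_rel_def by blast
  qed
  show "transp angle_rel"
  proof (rule transpI)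
    fix a b c assume "angle_rel a b" "angle_rel b c"
    then obtain k l :: int
      where "a - b = 2 * pi * of_int k" "b - c = 2 * pi * of_int l"
      unfolding angle_rel_def by blast
    then have "a - c = 2 * pi * of_int (k + l)" by (simp add: algebra_simps)
    then show "angle_rel a c" unfolding angle_rel_def by blast
  qed
qed

quotient_type angle = real / angle_rel
  by (rule equivp_angle_rel)

lift_definition to_angle :: "real \<Rightarrow> angle" is "\<lambda>t. t" .

lemma angle_rel_sin_cos:
  assumes "angle_rel a b"
  shows "sin a = sin b" "cos a = cos b"
proof -
  obtain k :: int where "a - b = 2 * pi * of_int k"
    using assms unfolding angle_rel_def by blast
  then have a: "a = b + 2 * pi * of_int k" by simp
  show "sin a = sin b" "cos a = cos b"
    unfolding a by (simp_all add: sin_add cos_add)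
qed

lift_definition angle_sin :: "angle \<Rightarrow> real" is sin
  by (rule angle_rel_sin_cos)

lift_definition angle_cos :: "angle \<Rightarrow> real" is cos
  by (rule angle_rel_sin_cos)

lift_definition rotate_angle :: "real \<Rightarrow> angle \<Rightarrow> angle" is "\<lambda>t a. a + t"
  by (simp add: angle_rel_def)

text \<open>
  The configuration space \<open>C\<close> is an open subset of \<open>\<real>\<^sup>2 \<times> T\<^sup>2\<close>. The forms
  \<open>dx\<^sub>1, dx\<^sub>2, d\<alpha>\<^sub>1, d\<alpha>\<^sub>2\<close> trivialise its cotangent bundle globally, so a covector
  \<open>p\<^sub>1 dx\<^sub>1 + p\<^sub>2 dx\<^sub>2 + \<eta>\<^sub>1 d\<alpha>\<^sub>1 + \<eta>\<^sub>2 d\<alpha>\<^sub>2\<close> at \<open>(x\<^sub>1, x\<^sub>2, \<alpha>\<^sub>1, \<alpha>\<^sub>2)\<close> is the tuple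
  \<open>(x\<^sub>1, x\<^sub>2, \<alpha>\<^sub>1, \<alpha>\<^sub>2, p\<^sub>1, p\<^sub>2, \<eta>\<^sub>1, \<eta>\<^sub>2)\<close>.
\<close>

definition linkage_configs :: "(real \<times> real \<times> angle \<times> angle) set" where
  "linkage_configs = {(x1, x2, \<alpha>1, \<alpha>2). \<alpha>1 \<noteq> \<alpha>2}"

type_synonym phase = "real \<times> real \<times> angle \<times> angle \<times> real \<times> real \<times> real \<times> real"

definition cotangent_bundle :: "phase set" where
  "cotangent_bundle =
     {(x1, x2, \<alpha>1, \<alpha>2, p1, p2, \<eta>1, \<eta>2). (x1, x2, \<alpha>1, \<alpha>2) \<in> linkage_configs}"

text \<open>
  Tangent vectors to the phase space, by their components with respect to the coordinate
  vector fields of \<open>(x\<^sub>1, x\<^sub>2, \<alpha>\<^sub>1, \<alpha>\<^sub>2, p\<^sub>1, p\<^sub>2, \<eta>\<^sub>1, \<eta>\<^sub>2)\<close>.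
  These fields are globally defined although the angles themselves are not.
\<close>

type_synonym tangent = "real \<times> real \<times> real \<times> real \<times> real \<times> real \<times> real \<times> real"

text \<open>
  For fixed \<open>m\<close>, the map \<open>\<lambda>v. displace v m\<close> is a local inverse of a coordinate chart
  that is centred at \<open>m\<close>.
\<close>

fun displace :: "tangent \<Rightarrow> phase \<Rightarrow> phase" where
  "displace (u1, u2, a1, a2, q1, q2, h1, h2) (x1, x2, \<alpha>1, \<alpha>2, p1, p2, \<eta>1, \<eta>2) =
     (x1 + u1, x2 + u2, rotate_angle a1 \<alpha>1, rotate_angle a2 \<alpha>2,
      p1 + q1, p2 + q2, \<eta>1 + h1, \<eta>2 + h2)"

definition differential :: "(phase \<Rightarrow> real) \<Rightarrow> phase \<Rightarrow> (tangent \<Rightarrow>\<^sub>L real)" where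
  "differential f m = Blinfun (frechet_derivative (\<lambda>v. f (displace v m)) (at 0))"

text \<open>\<open>dx\<^sub>1 \<and> dp\<^sub>1 + dx\<^sub>2 \<and> dp\<^sub>2 + d\<alpha>\<^sub>1 \<and> d\<eta>\<^sub>1 + d\<alpha>\<^sub>2 \<and> d\<eta>\<^sub>2\<close>\<close>

fun symplectic_form :: "tangent \<Rightarrow> tangent \<Rightarrow> real" where
  "symplectic_form (u1, u2, a1, a2, q1, q2, h1, h2) (u1', u2', a1', a2', q1', q2', h1', h2') =
     (u1 * q1' - q1 * u1') + (u2 * q2' - q2 * u2') +
     (a1 * h1' - h1 * a1') + (a2 * h2' - h2 * a2')"

definition hamiltonian_vf :: "(phase \<Rightarrow> real) \<Rightarrow> phase \<Rightarrow> tangent" where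
  "hamiltonian_vf f m = (THE X. \<forall>v. symplectic_form X v = blinfun_apply (differential f m) v)"

definition poisson_bracket :: "(phase \<Rightarrow> real) \<Rightarrow> (phase \<Rightarrow> real) \<Rightarrow> phase \<Rightarrow> real" where
  "poisson_bracket f g m = symplectic_form (hamiltonian_vf f m) (hamiltonian_vf g m)"

lemma hamiltonian_vf_eq:
  "hamiltonian_vf f m =
    (let d = blinfun_apply (differential f m) in
     (d (0,0,0,0,1,0,0,0), d (0,0,0,0,0,1,0,0), d (0,0,0,0,0,0,1,0), d (0,0,0,0,0,0,0,1),
      - d (1,0,0,0,0,0,0,0), - d (0,1,0,0,0,0,0,0), - d (0,0,1,0,0,0,0,0), - d (0,0,0,1,0,0,0,0)))"
proof -
  define d where "d = blinfun_apply (differential f m)"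
  have lin: "linear d"
    unfolding d_def by (intro bounded_linear.linear blinfun.bounded_linear_right)
  let ?X = "(d (0,0,0,0,1,0,0,0), d (0,0,0,0,0,1,0,0), d (0,0,0,0,0,0,1,0), d (0,0,0,0,0,0,0,1),
      - d (1,0,0,0,0,0,0,0), - d (0,1,0,0,0,0,0,0), - d (0,0,1,0,0,0,0,0), - d (0,0,0,1,0,0,0,0))"
  have ex: "symplectic_form ?X v = d v" for v
  proof -
    obtain u1 u2 a1 a2 q1 q2 h1 h2 where v: "v = (u1, u2, a1, a2, q1, q2, h1, h2)"
      by (metis prod.collapse)
    have "v = u1 *\<^sub>R (1,0,0,0,0,0,0,0) + u2 *\<^sub>R (0,1,0,0,0,0,0,0) + a1 *\<^sub>R (0,0,1,0,0,0,0,0)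
        + a2 *\<^sub>R (0,0,0,1,0,0,0,0) + q1 *\<^sub>R (0,0,0,0,1,0,0,0) + q2 *\<^sub>R (0,0,0,0,0,1,0,0)
        + h1 *\<^sub>R (0,0,0,0,0,0,1,0) + h2 *\<^sub>R (0,0,0,0,0,0,0,1)"
      by (simp add: v)
    from arg_cong[OF this, of d] have "d v = u1 * d (1,0,0,0,0,0,0,0) + u2 * d (0,1,0,0,0,0,0,0)
        + a1 * d (0,0,1,0,0,0,0,0) + a2 * d (0,0,0,1,0,0,0,0)
        + q1 * d (0,0,0,0,1,0,0,0) + q2 * d (0,0,0,0,0,1,0,0)
        + h1 * d (0,0,0,0,0,0,1,0) + h2 * d (0,0,0,0,0,0,0,1)"
      by (simp only: linear_add[OF lin] linear_scale[OF lin] real_scaleR_def)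
    then show ?thesis by (simp add: v mult.commute)
  qed
  have uniq: "X = ?X" if "\<forall>v. symplectic_form X v = d v" for X
  proof -
    obtain u1 u2 a1 a2 q1 q2 h1 h2 where X: "X = (u1, u2, a1, a2, q1, q2, h1, h2)"
      by (metis prod.collapse)
    show ?thesis unfolding that[rule_format, symmetric] by (simp add: X)
  qed
  have "(THE X. \<forall>v. symplectic_form X v = d v) = ?X"
    using ex uniq by (intro the_equality) blast+
  then show ?thesis unfolding hamiltonian_vf_def d_def Let_def .
qed

text \<open>
  \<open>angle_coords\<close> is the covering \<open>\<real>\<^sup>8 \<rightarrow> \<real>\<^sup>2 \<times> T\<^sup>2 \<times> \<real>\<^sup>4\<close>. It is a local inverse of every
  coordinate chart, and countably many of its restrictions parametrise everything. A subset of
  the manifold therefore has measure zero iff its preimage in \<open>\<real>\<^sup>8\<close> is a Lebesgue null set.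
\<close>

fun angle_coords :: "tangent \<Rightarrow> phase" where
  "angle_coords (x1, x2, a1, a2, p1, p2, \<eta>1, \<eta>2) =
     (x1, x2, to_angle a1, to_angle a2, p1, p2, \<eta>1, \<eta>2)"

definition almost_everywhere :: "(phase \<Rightarrow> bool) \<Rightarrow> bool" where
  "almost_everywhere P \<longleftrightarrow>
     (AE u in lebesgue. angle_coords u \<in> cotangent_bundle \<longrightarrow> P (angle_coords u))"

text \<open>
  Linear independence is that of the list of differentials; \<open>distinct\<close> is needed because
  \<open>set\<close> forgets repetitions.
\<close>

definition functionally_independent_ae :: "(phase \<Rightarrow> real) list \<Rightarrow> bool" where
  "functionally_independent_ae fs \<longleftrightarrow>
     almost_everywhere (\<lambda>m. let ds = map (\<lambda>f. differential f m) fs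
                            in distinct ds \<and> independent (set ds))"

fun mom1 :: "phase \<Rightarrow> real" where
  "mom1 (x1, x2, \<alpha>1, \<alpha>2, p1, p2, \<eta>1, \<eta>2) = p1"

fun mom2 :: "phase \<Rightarrow> real" where
  "mom2 (x1, x2, \<alpha>1, \<alpha>2, p1, p2, \<eta>1, \<eta>2) = p2"

fun ham :: "phase \<Rightarrow> real" where
  "ham (x1, x2, \<alpha>1, \<alpha>2, p1, p2, \<eta>1, \<eta>2) =
     1/2 * ((p1 - \<eta>1 * angle_sin \<alpha>1 - \<eta>2 * angle_sin \<alpha>2)\<^sup>2
          + (p2 + \<eta>1 * angle_cos \<alpha>1 + \<eta>2 * angle_cos \<alpha>2)\<^sup>2)"

fun G_integral :: "phase \<Rightarrow> real" where
  "G_integral (x1, x2, \<alpha>1, \<alpha>2, p1, p2, \<eta>1, \<eta>2) =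
       p1 * (p1 - \<eta>1 * angle_sin \<alpha>1 - \<eta>2 * angle_sin \<alpha>2)
     + p2 * (p2 + \<eta>1 * angle_cos \<alpha>1 + \<eta>2 * angle_cos \<alpha>2)
     + 1/2 * (\<eta>1 + \<eta>2)\<^sup>2"

end

theory Submission
  imports Defs
begin

text \<open>
  Everything is computed in the covering coordinates \<open>angle_coords\<close>, in which the four functions
  are polynomials in \<open>p\<close>, \<open>\<eta>\<close> and the sines and cosines of the angles. Write
  \<open>A = p\<^sub>1 - \<eta>\<^sub>1 sin \<alpha>\<^sub>1 - \<eta>\<^sub>2 sin \<alpha>\<^sub>2\<close>, \<open>B = p\<^sub>2 + \<eta>\<^sub>1 cos \<alpha>\<^sub>1 + \<eta>\<^sub>2 cos \<alpha>\<^sub>2\<close> and \<open>E = \<eta>\<^sub>1 + \<eta>\<^sub>2\<close>, so that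
  \<open>H = (A\<^sup>2 + B\<^sup>2) / 2\<close> and \<open>G = p\<^sub>1 A + p\<^sub>2 B + E\<^sup>2 / 2\<close>.

  \<^bold>\<open>Commutation.\<close> No function depends on \<open>x\<close>, so \<open>p\<^sub>1\<close> and \<open>p\<^sub>2\<close> commute with all of them, and only
  \<open>{H, G}\<close> has to be computed. The pair \<open>(\<alpha>\<^sub>i, \<eta>\<^sub>i)\<close> contributes to it the Jacobian minor
  \<open>M\<^sub>i = \<eta>\<^sub>i (B p\<^sub>1 - A p\<^sub>2 - E (A cos \<alpha>\<^sub>i + B sin \<alpha>\<^sub>i))\<close>. Since \<open>\<Sum>\<^sub>i \<eta>\<^sub>i cos \<alpha>\<^sub>i = B - p\<^sub>2\<close> and
  \<open>\<Sum>\<^sub>i \<eta>\<^sub>i sin \<alpha>\<^sub>i = p\<^sub>1 - A\<close>, the two minors add up to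
  \<open>E (B p\<^sub>1 - A p\<^sub>2) - E (A (B - p\<^sub>2) + B (p\<^sub>1 - A)) = 0\<close>.

  \<^bold>\<open>Independence.\<close> The forms \<open>dp\<^sub>1\<close> and \<open>dp\<^sub>2\<close> vanish on \<open>\<partial>/\<partial>\<alpha>\<^sub>1\<close> and \<open>\<partial>/\<partial>\<eta>\<^sub>1\<close>, so the four
  differentials are independent wherever \<open>M\<^sub>1 \<noteq> 0\<close>. Substituting \<open>A\<close> and \<open>B\<close> gives
  \<open>M\<^sub>1 = \<eta>\<^sub>1 \<eta>\<^sub>2 (p\<^sub>1 (cos \<alpha>\<^sub>2 - cos \<alpha>\<^sub>1) + p\<^sub>2 (sin \<alpha>\<^sub>2 - sin \<alpha>\<^sub>1) - E sin (\<alpha>\<^sub>1 - \<alpha>\<^sub>2))\<close>.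
  The first two factors have slope \<open>1\<close> along the \<open>\<eta>\<^sub>1\<close> and \<open>\<eta>\<^sub>2\<close> axes. For \<open>\<alpha>\<^sub>1 \<noteq> \<alpha>\<^sub>2\<close> on the
  circle, the last one is affine with nonzero slope along the \<open>p\<^sub>1\<close> axis or along the \<open>p\<^sub>2\<close> axis.
  The part of a zero set where the slope along a fixed direction is nonzero meets every line in
  that direction at most once, so it is a null set by Fubini's theorem and translation
  invariance (\<open>null_sets_affine_along_line\<close>).
\<close>


section \<open>Null sets from a transversal direction\<close>

text \<open>
  By translation invariance, the slice at every \<open>t\<close> of \<open>{(u, t). u + t v \<in> S}\<close> has the measure of
  \<open>S\<close>, while its slice at every \<open>u\<close> is a null set. Exchanging the order of integration gives
  \<open>\<infinity> \<cdot> \<lambda>(S) = 0\<close>. In this form the direction \<open>v\<close> need not be split off as a factor of the space.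
\<close>

lemma null_sets_if_null_on_parallel_lines:
  fixes S :: "'a::euclidean_space set" and v :: 'a
  assumes S [measurable]: "S \<in> sets borel"
    and null: "\<And>u. {t::real. u + t *\<^sub>R v \<in> S} \<in> null_sets lborel"
  shows "S \<in> null_sets lborel"
proof -
  have slice: "(\<integral>\<^sup>+u. indicator S (u + t *\<^sub>R v) \<partial>lborel) = emeasure lborel S" for t
  proof -
    have "emeasure lborel S = (\<integral>\<^sup>+u. indicator S u \<partial>distr lborel borel ((+) (t *\<^sub>R v)))"
      by (simp add: lborel_distr_plus)
    also have "\<dots> = (\<integral>\<^sup>+u. indicator S (t *\<^sub>R v + u) \<partial>lborel)"
      by (rule nn_integral_distr) auto
    finally show ?thesis by (simp add: add.commute)
  qed
  have line: "(\<integral>\<^sup>+t. indicator S (u + t *\<^sub>R v) \<partial>lborel) = 0" for u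
  proof -
    have "(\<integral>\<^sup>+t. indicator S (u + t *\<^sub>R v) \<partial>lborel)
        = (\<integral>\<^sup>+t. indicator {t. u + t *\<^sub>R v \<in> S} t \<partial>lborel)"
      by (intro nn_integral_cong) (auto simp: indicator_def)
    also have "\<dots> = 0"
      using null[of u] by (simp add: null_sets_def)
    finally show ?thesis .
  qed
  have "emeasure lborel S * \<infinity> = (\<integral>\<^sup>+t. emeasure lborel S \<partial>(lborel :: real measure))"
    by simp
  also have "\<dots> = (\<integral>\<^sup>+t. (\<integral>\<^sup>+u. indicator S (u + t *\<^sub>R v) \<partial>lborel) \<partial>lborel)"
    by (simp only: slice)
  also have "\<dots> = (\<integral>\<^sup>+u. (\<integral>\<^sup>+t. indicator S (u + t *\<^sub>R v) \<partial>lborel) \<partial>lborel)"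
    by (rule lborel_pair.Fubini') measurable
  also have "\<dots> = 0"
    by (simp only: line) simp
  finally have "emeasure lborel S = 0"
    by (simp add: ennreal_mult_eq_top_iff)
  then show ?thesis
    using S by (simp add: null_sets_def)
qed

lemma null_sets_affine_along_line:
  fixes F k :: "'a::euclidean_space \<Rightarrow> real"
  assumes "continuous_on UNIV F" "continuous_on UNIV k"
    and affine: "\<And>u t. F (u + t *\<^sub>R v) = F u + t * k u"
  shows "{u. k u \<noteq> 0 \<and> F u = 0} \<in> null_sets lborel"
proof (rule null_sets_if_null_on_parallel_lines)
  have "open {u. k u \<noteq> 0}" "closed {u. F u = 0}"
    using assms by (auto intro!: open_Collect_neq closed_Collect_eq continuous_intros)
  then have "{u. k u \<noteq> 0} \<inter> {u. F u = 0} \<in> sets borel"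
    by (intro sets.Int borel_open borel_closed)
  then show "{u. k u \<noteq> 0 \<and> F u = 0} \<in> sets borel"
    by (simp add: Collect_conj_eq)
next
  fix u
  \<comment> \<open>The slope \<open>k\<close> is constant along the line, since \<open>F\<close> is affine there.\<close>
  have k: "k (u + t *\<^sub>R v) = k u" for t
    using affine[of "u + t *\<^sub>R v" 1] affine[of u t] affine[of u "t + 1"]
    by (simp add: algebra_simps)
  have "{t. u + t *\<^sub>R v \<in> {u. k u \<noteq> 0 \<and> F u = 0}} \<subseteq> {- F u / k u}"
    by (auto simp: k affine field_simps)
  then have "finite {t. u + t *\<^sub>R v \<in> {u. k u \<noteq> 0 \<and> F u = 0}}"
    by (rule finite_subset) simp
  then show "{t. u + t *\<^sub>R v \<in> {u. k u \<noteq> 0 \<and> F u = 0}} \<in> null_sets lborel"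
    by (rule finite_imp_null_set_lborel)
qed


section \<open>Linear independence of lists\<close>

lemma distinct_independent_if_trivial_relations:
  fixes xs :: "'a::real_vector list"
  assumes triv: "\<And>c i. (\<Sum>i<length xs. c i *\<^sub>R xs ! i) = 0 \<Longrightarrow> i < length xs \<Longrightarrow> c i = 0"
  shows "distinct xs \<and> independent (set xs)"
proof
  show dist: "distinct xs"
    unfolding distinct_conv_nth
  proof (intro allI impI notI)
    fix i j assume ij: "i < length xs" "j < length xs" "i \<noteq> j" "xs ! i = xs ! j"
    let ?c = "\<lambda>l. (if l = i then 1 else 0) - (if l = j then 1 else (0::real))"
    have "(\<Sum>l<length xs. ?c l *\<^sub>R xs ! l)
        = (\<Sum>l<length xs. if l = i then xs ! l else 0) - (\<Sum>l<length xs. if l = j then xs ! l else 0)"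
      unfolding sum_subtractf[symmetric] by (intro sum.cong) auto
    also have "\<dots> = 0"
      using ij by simp
    finally show False
      using triv[of ?c i] ij by simp
  qed
  show "independent (set xs)"
  proof (rule independent_if_scalars_zero)
    fix f x assume f: "(\<Sum>x\<in>set xs. f x *\<^sub>R x) = 0" and x: "x \<in> set xs"
    have "(\<Sum>i<length xs. f (xs ! i) *\<^sub>R xs ! i) = (\<Sum>x\<in>set xs. f x *\<^sub>R x)"
      by (rule sum.reindex_bij_betw[OF bij_betw_nth[OF dist refl refl]])
    moreover obtain i where "i < length xs" "x = xs ! i"
      using x by (auto simp: in_set_conv_nth)
    ultimately show "f x = 0"
      using triv[of "\<lambda>i. f (xs ! i)" i] f by simp
  qed simp
qed


section \<open>Differentials in the covering coordinates\<close>

lemma angle_coords_surj: obtains u where "m = angle_coords u"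
proof -
  have ang: "\<exists>a. \<alpha> = to_angle a" for \<alpha>
    by transfer (auto simp: angle_rel_def intro!: exI[of _ "0::int"])
  obtain x1 x2 \<alpha>1 \<alpha>2 p1 p2 \<eta>1 \<eta>2 where m: "m = (x1, x2, \<alpha>1, \<alpha>2, p1, p2, \<eta>1, \<eta>2)"
    by (metis prod.collapse)
  obtain a1 a2 where "\<alpha>1 = to_angle a1" "\<alpha>2 = to_angle a2"
    using ang by blast
  then show ?thesis
    using that[of "(x1, x2, a1, a2, p1, p2, \<eta>1, \<eta>2)"] m by simp
qed

lemma displace_angle_coords: "displace v (angle_coords u) = angle_coords (u + v)"
proof -
  have "rotate_angle t (to_angle a) = to_angle (a + t)" for t a
    by transfer (auto simp: angle_rel_def intro!: exI[of _ "0::int"])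
  then show ?thesis
    by (cases u; cases v) auto
qed

lemma differential_angle_coords:
  assumes "((\<lambda>u. f (angle_coords u)) has_derivative f') (at u)"
  shows "blinfun_apply (differential f (angle_coords u)) = f'"
proof -
  have "((\<lambda>v. u + v) has_derivative (\<lambda>v. v)) (at 0)"
    by (auto intro!: derivative_eq_intros)
  moreover have "((\<lambda>u. f (angle_coords u)) has_derivative f') (at (u + 0))"
    using assms by simp
  ultimately have d: "((\<lambda>v. f (displace v (angle_coords u))) has_derivative f') (at 0)"
    using has_derivative_compose unfolding displace_angle_coords by blast
  then show ?thesis
    unfolding differential_def
    by (simp add: frechet_derivative_at[OF d, symmetric] bounded_linear_Blinfun_apply
        has_derivative_bounded_linear)
qed

lemma angle_sin_to_angle [simp]: "angle_sin (to_angle a) = sin a"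
  by transfer simp

lemma angle_cos_to_angle [simp]: "angle_cos (to_angle a) = cos a"
  by transfer simp

lemma to_angle_neq_imp:
  assumes "to_angle a \<noteq> to_angle b"
  shows "cos a \<noteq> cos b \<or> sin a \<noteq> sin b"
proof -
  have "\<not> angle_rel a b"
    using assms by transfer
  then show ?thesis
    using sin_cos_eq_iff[of a b] by (auto simp: angle_rel_def algebra_simps)
qed

lemma differential_mom1:
  "blinfun_apply (differential mom1 (angle_coords u)) (x1', x2', a1', a2', p1', p2', h1', h2') = p1'"
proof -
  have "(\<lambda>u. mom1 (angle_coords u)) = (\<lambda>u. fst (snd (snd (snd (snd u)))))"
    by auto
  then have "((\<lambda>u. mom1 (angle_coords u)) has_derivative
      (\<lambda>u. fst (snd (snd (snd (snd u)))))) (at u)"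
    by (auto intro!: derivative_eq_intros)
  from differential_angle_coords[OF this] show ?thesis by simp
qed

lemma differential_mom2:
  "blinfun_apply (differential mom2 (angle_coords u)) (x1', x2', a1', a2', p1', p2', h1', h2') = p2'"
proof -
  have "(\<lambda>u. mom2 (angle_coords u)) = (\<lambda>u. fst (snd (snd (snd (snd (snd u))))))"
    by auto
  then have "((\<lambda>u. mom2 (angle_coords u)) has_derivative
      (\<lambda>u. fst (snd (snd (snd (snd (snd u))))))) (at u)"
    by (auto intro!: derivative_eq_intros)
  from differential_angle_coords[OF this] show ?thesis by simp
qed

lemma differential_ham:
  fixes a1 a2 p1 p2 h1 h2 :: real
  defines "A \<equiv> p1 - h1 * sin a1 - h2 * sin a2"
    and "B \<equiv> p2 + h1 * cos a1 + h2 * cos a2"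
  shows "blinfun_apply (differential ham (angle_coords (x1, x2, a1, a2, p1, p2, h1, h2)))
      (x1', x2', a1', a2', p1', p2', h1', h2')
    = A * (p1' - h1' * sin a1 - h1 * cos a1 * a1' - h2' * sin a2 - h2 * cos a2 * a2')
    + B * (p2' + h1' * cos a1 - h1 * sin a1 * a1' + h2' * cos a2 - h2 * sin a2 * a2')"
proof -
  let ?a1 = "\<lambda>u::tangent. fst (snd (snd u))"
  let ?a2 = "\<lambda>u::tangent. fst (snd (snd (snd u)))"
  let ?p1 = "\<lambda>u::tangent. fst (snd (snd (snd (snd u))))"
  let ?p2 = "\<lambda>u::tangent. fst (snd (snd (snd (snd (snd u)))))"
  let ?h1 = "\<lambda>u::tangent. fst (snd (snd (snd (snd (snd (snd u))))))"
  let ?h2 = "\<lambda>u::tangent. snd (snd (snd (snd (snd (snd (snd u))))))"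
  have "(\<lambda>u. ham (angle_coords u)) = (\<lambda>u.
      1/2 * ((?p1 u - ?h1 u * sin (?a1 u) - ?h2 u * sin (?a2 u))\<^sup>2
        + (?p2 u + ?h1 u * cos (?a1 u) + ?h2 u * cos (?a2 u))\<^sup>2))"
    by auto
  then have "((\<lambda>u. ham (angle_coords u)) has_derivative (\<lambda>v.
      A * (?p1 v - ?h1 v * sin a1 - h1 * cos a1 * ?a1 v - ?h2 v * sin a2 - h2 * cos a2 * ?a2 v)
    + B * (?p2 v + ?h1 v * cos a1 - h1 * sin a1 * ?a1 v + ?h2 v * cos a2 - h2 * sin a2 * ?a2 v)))
      (at (x1, x2, a1, a2, p1, p2, h1, h2))"
    unfolding A_def B_def
    by (auto intro!: derivative_eq_intros ext simp: field_simps)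
  from differential_angle_coords[OF this] show ?thesis by simp
qed

lemma differential_G_integral:
  fixes a1 a2 p1 p2 h1 h2 :: real
  defines "A \<equiv> p1 - h1 * sin a1 - h2 * sin a2"
    and "B \<equiv> p2 + h1 * cos a1 + h2 * cos a2"
  shows "blinfun_apply (differential G_integral (angle_coords (x1, x2, a1, a2, p1, p2, h1, h2)))
      (x1', x2', a1', a2', p1', p2', h1', h2')
    = p1' * A + p2' * B
    + p1 * (p1' - h1' * sin a1 - h1 * cos a1 * a1' - h2' * sin a2 - h2 * cos a2 * a2')
    + p2 * (p2' + h1' * cos a1 - h1 * sin a1 * a1' + h2' * cos a2 - h2 * sin a2 * a2')
    + (h1 + h2) * (h1' + h2')"
proof -
  let ?a1 = "\<lambda>u::tangent. fst (snd (snd u))"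
  let ?a2 = "\<lambda>u::tangent. fst (snd (snd (snd u)))"
  let ?p1 = "\<lambda>u::tangent. fst (snd (snd (snd (snd u))))"
  let ?p2 = "\<lambda>u::tangent. fst (snd (snd (snd (snd (snd u)))))"
  let ?h1 = "\<lambda>u::tangent. fst (snd (snd (snd (snd (snd (snd u))))))"
  let ?h2 = "\<lambda>u::tangent. snd (snd (snd (snd (snd (snd (snd u))))))"
  have "(\<lambda>u. G_integral (angle_coords u)) = (\<lambda>u.
      ?p1 u * (?p1 u - ?h1 u * sin (?a1 u) - ?h2 u * sin (?a2 u))
        + ?p2 u * (?p2 u + ?h1 u * cos (?a1 u) + ?h2 u * cos (?a2 u))
        + 1/2 * (?h1 u + ?h2 u)\<^sup>2)"
    by auto
  then have "((\<lambda>u. G_integral (angle_coords u)) has_derivative (\<lambda>v.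
      ?p1 v * A + ?p2 v * B
    + p1 * (?p1 v - ?h1 v * sin a1 - h1 * cos a1 * ?a1 v - ?h2 v * sin a2 - h2 * cos a2 * ?a2 v)
    + p2 * (?p2 v + ?h1 v * cos a1 - h1 * sin a1 * ?a1 v + ?h2 v * cos a2 - h2 * sin a2 * ?a2 v)
    + (h1 + h2) * (?h1 v + ?h2 v)))
      (at (x1, x2, a1, a2, p1, p2, h1, h2))"
    unfolding A_def B_def
    by (auto intro!: derivative_eq_intros ext simp: field_simps)
  from differential_angle_coords[OF this] show ?thesis by simp
qed


section \<open>Commutation\<close>

lemma symplectic_form_antisym: "symplectic_form X Y = - symplectic_form Y X"
  by (cases X; cases Y) auto

lemma poisson_bracket_antisym: "poisson_bracket f g m = - poisson_bracket g f m"
  unfolding poisson_bracket_def by (rule symplectic_form_antisym)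

lemma poisson_bracket_self: "poisson_bracket f f m = 0"
  using poisson_bracket_antisym[of f f m] by simp

text \<open>
  The two summands are the minors \<open>M\<^sub>1\<close> and \<open>M\<^sub>2\<close> of the bracket \<open>{H, G}\<close>. Stating their cancellation
  for arbitrary points \<open>(c\<^sub>i, s\<^sub>i)\<close> of the unit circle makes it a polynomial identity.
\<close>

lemma minors_cancel:
  fixes s1 c1 s2 c2 p1 p2 h1 h2 :: real
  defines "A \<equiv> p1 - h1 * s1 - h2 * s2"
    and "B \<equiv> p2 + h1 * c1 + h2 * c2"
    and "E \<equiv> h1 + h2"
  assumes "s1\<^sup>2 + c1\<^sup>2 = 1" "s2\<^sup>2 + c2\<^sup>2 = 1"
  shows "h1 * ((B * c1 - A * s1) * (p1 * c1 + p2 * s1) - (A * c1 + B * s1) * (p2 * c1 - p1 * s1 + E))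
       + h2 * ((B * c2 - A * s2) * (p1 * c2 + p2 * s2) - (A * c2 + B * s2) * (p2 * c2 - p1 * s2 + E))
       = 0"
proof -
  have minor: "(B * c - A * s) * (p1 * c + p2 * s) - (A * c + B * s) * (p2 * c - p1 * s + E)
      = B * p1 - A * p2 - E * (A * c + B * s)" if "s\<^sup>2 + c\<^sup>2 = 1" for s c
    using that by algebra
  show ?thesis
    unfolding minor[OF assms(4)] minor[OF assms(5)] unfolding A_def B_def E_def by algebra
qed

lemma poisson_bracket_ham_G_integral: "poisson_bracket ham G_integral (angle_coords u) = 0"
proof -
  obtain x1 x2 a1 a2 p1 p2 h1 h2 where u: "u = (x1, x2, a1, a2, p1, p2, h1, h2)"
    by (metis prod.collapse)
  define A where "A = p1 - h1 * sin a1 - h2 * sin a2"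
  define B where "B = p2 + h1 * cos a1 + h2 * cos a2"
  note diffs = differential_ham[of x1 x2 a1 a2 p1 p2 h1 h2, folded A_def B_def]
    differential_G_integral[of x1 x2 a1 a2 p1 p2 h1 h2, folded A_def B_def]
  have "poisson_bracket ham G_integral (angle_coords u)
      = h1 * ((B * cos a1 - A * sin a1) * (p1 * cos a1 + p2 * sin a1)
            - (A * cos a1 + B * sin a1) * (p2 * cos a1 - p1 * sin a1 + (h1 + h2)))
      + h2 * ((B * cos a2 - A * sin a2) * (p1 * cos a2 + p2 * sin a2)
            - (A * cos a2 + B * sin a2) * (p2 * cos a2 - p1 * sin a2 + (h1 + h2)))"
    unfolding poisson_bracket_def hamiltonian_vf_eq Let_def u
    by (simp add: diffs algebra_simps del: angle_coords.simps)
  also have "\<dots> = 0"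
    unfolding A_def B_def by (rule minors_cancel) simp_all
  finally show ?thesis .
qed

lemma poisson_bracket_mom:
  "poisson_bracket mom1 mom2 (angle_coords u) = 0"
  "poisson_bracket mom1 ham (angle_coords u) = 0"
  "poisson_bracket mom2 ham (angle_coords u) = 0"
  "poisson_bracket mom1 G_integral (angle_coords u) = 0"
  "poisson_bracket mom2 G_integral (angle_coords u) = 0"
proof -
  obtain x1 x2 a1 a2 p1 p2 h1 h2 where u: "u = (x1, x2, a1, a2, p1, p2, h1, h2)"
    by (metis prod.collapse)
  note simps = poisson_bracket_def hamiltonian_vf_eq Let_def
    differential_mom1 differential_mom2 differential_ham differential_G_integral
  show "poisson_bracket mom1 mom2 (angle_coords u) = 0"
    "poisson_bracket mom1 ham (angle_coords u) = 0"
    "poisson_bracket mom2 ham (angle_coords u) = 0"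
    "poisson_bracket mom1 G_integral (angle_coords u) = 0"
    "poisson_bracket mom2 G_integral (angle_coords u) = 0"
    by (simp_all add: u simps del: angle_coords.simps)
qed

lemma poisson_commute:
  assumes "f \<in> {ham, mom1, mom2, G_integral}" "g \<in> {ham, mom1, mom2, G_integral}"
  shows "poisson_bracket f g m = 0"
proof -
  obtain u where "m = angle_coords u"
    by (rule angle_coords_surj)
  then show ?thesis
    using assms poisson_bracket_ham_G_integral[of u] poisson_bracket_mom[of u]
      poisson_bracket_antisym[of _ ham m] poisson_bracket_antisym[of G_integral _ m]
      poisson_bracket_antisym[of mom2 mom1 m]
    by (auto simp: poisson_bracket_self)
qed


section \<open>Functional independence\<close>

text \<open>
  Evaluating a linear relation among the differentials on \<open>\<partial>/\<partial>\<alpha>\<^sub>1\<close> and \<open>\<partial>/\<partial>\<eta>\<^sub>1\<close> leaves a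
  \<open>2 \<times> 2\<close> system for the coefficients of \<open>dH\<close> and \<open>dG\<close>; up to sign, its determinant is the
  product of the three quantities assumed to be nonzero.
\<close>

lemma differentials_independent:
  fixes a1 a2 p1 p2 h1 h2 :: real
  assumes "h1 \<noteq> 0" "h2 \<noteq> 0"
    and L: "p1 * (cos a2 - cos a1) + p2 * (sin a2 - sin a1) - (h1 + h2) * sin (a1 - a2) \<noteq> 0"
  shows "let ds = map (\<lambda>f. differential f (angle_coords (x1, x2, a1, a2, p1, p2, h1, h2)))
                    [ham, mom1, mom2, G_integral]
         in distinct ds \<and> independent (set ds)"
proof -
  let ?m = "angle_coords (x1, x2, a1, a2, p1, p2, h1, h2)"
  let ?ds = "map (\<lambda>f. differential f ?m) [ham, mom1, mom2, G_integral]"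
  have "distinct ?ds \<and> independent (set ?ds)"
  proof (rule distinct_independent_if_trivial_relations)
    fix c :: "nat \<Rightarrow> real" and i
    assume rel: "(\<Sum>i<length ?ds. c i *\<^sub>R ?ds ! i) = 0" and i: "i < length ?ds"
    have "c 0 *\<^sub>R differential ham ?m + c 1 *\<^sub>R differential mom1 ?m
        + c 2 *\<^sub>R differential mom2 ?m + c 3 *\<^sub>R differential G_integral ?m = 0"
      using rel by (simp add: eval_nat_numeral lessThan_Suc add_ac del: angle_coords.simps)
    then have "blinfun_apply (c 0 *\<^sub>R differential ham ?m + c 1 *\<^sub>R differential mom1 ?m
        + c 2 *\<^sub>R differential mom2 ?m + c 3 *\<^sub>R differential G_integral ?m) v = 0" for v
      by (simp only: blinfun.zero_left)
    then have ev: "c 0 * blinfun_apply (differential ham ?m) v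
        + c 1 * blinfun_apply (differential mom1 ?m) v
        + c 2 * blinfun_apply (differential mom2 ?m) v
        + c 3 * blinfun_apply (differential G_integral ?m) v = 0" for v
      by (simp add: blinfun.add_left blinfun.scaleR_left del: angle_coords.simps)
    define A where "A = p1 - h1 * sin a1 - h2 * sin a2"
    define B where "B = p2 + h1 * cos a1 + h2 * cos a2"
    note simps = differential_mom1 differential_mom2
      differential_ham[of x1 x2 a1 a2 p1 p2 h1 h2, folded A_def B_def]
      differential_G_integral[of x1 x2 a1 a2 p1 p2 h1 h2, folded A_def B_def]
    define Ha where "Ha = h1 * (A * cos a1 + B * sin a1)"
    define Ga where "Ga = h1 * (p1 * cos a1 + p2 * sin a1)"
    define He where "He = B * cos a1 - A * sin a1"
    define Ge where "Ge = p2 * cos a1 - p1 * sin a1 + (h1 + h2)"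
    have e1: "c 0 * Ha + c 3 * Ga = 0"
      using ev[of "(0,0,1,0,0,0,0,0)"]
      by (simp add: simps Ha_def Ga_def algebra_simps del: angle_coords.simps)
    have e2: "c 0 * He + c 3 * Ge = 0"
      using ev[of "(0,0,0,0,0,0,1,0)"]
      by (simp add: simps He_def Ge_def algebra_simps del: angle_coords.simps)
    have det: "He * Ga - Ha * Ge
        = h1 * h2 * (p1 * (cos a2 - cos a1) + p2 * (sin a2 - sin a1) - (h1 + h2) * sin (a1 - a2))"
      using sin_cos_squared_add[of a1]
      unfolding Ha_def Ga_def He_def Ge_def A_def B_def sin_diff by algebra
    then have nz: "He * Ga - Ha * Ge \<noteq> 0"
      using assms by simp
    have "c 0 * (He * Ga - Ha * Ge) = 0" "c 3 * (He * Ga - Ha * Ge) = 0"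
      using e1 e2 by algebra+
    then have c03: "c 0 = 0" "c 3 = 0"
      using nz by auto
    have "c 1 = 0"
      using ev[of "(0,0,0,0,1,0,0,0)"] c03 by (simp add: simps del: angle_coords.simps)
    moreover have "c 2 = 0"
      using ev[of "(0,0,0,0,0,1,0,0)"] c03 by (simp add: simps del: angle_coords.simps)
    moreover have "i = 0 \<or> i = 1 \<or> i = 2 \<or> i = 3"
      using i by auto
    ultimately show "c i = 0"
      using c03 by auto
  qed
  then show ?thesis
    unfolding Let_def .
qed

lemma functionally_independent: "functionally_independent_ae [ham, mom1, mom2, G_integral]"
proof -
  let ?a1 = "\<lambda>u::tangent. fst (snd (snd u))"
  let ?a2 = "\<lambda>u::tangent. fst (snd (snd (snd u)))"
  let ?p1 = "\<lambda>u::tangent. fst (snd (snd (snd (snd u))))"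
  let ?p2 = "\<lambda>u::tangent. fst (snd (snd (snd (snd (snd u)))))"
  let ?h1 = "\<lambda>u::tangent. fst (snd (snd (snd (snd (snd (snd u))))))"
  let ?h2 = "\<lambda>u::tangent. snd (snd (snd (snd (snd (snd (snd u))))))"
  let ?L = "\<lambda>u. ?p1 u * (cos (?a2 u) - cos (?a1 u)) + ?p2 u * (sin (?a2 u) - sin (?a1 u))
      - (?h1 u + ?h2 u) * sin (?a1 u - ?a2 u)"
  have "{u. (1::real) \<noteq> 0 \<and> ?h1 u = 0} \<in> null_sets lborel"
    by (rule null_sets_affine_along_line[where v = "(0,0,0,0,0,0,1,0)"])
      (auto intro!: continuous_intros)
  moreover have "{u. (1::real) \<noteq> 0 \<and> ?h2 u = 0} \<in> null_sets lborel"
    by (rule null_sets_affine_along_line[where v = "(0,0,0,0,0,0,0,1)"])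
      (auto intro!: continuous_intros)
  moreover have "{u. cos (?a2 u) - cos (?a1 u) \<noteq> 0 \<and> ?L u = 0} \<in> null_sets lborel"
    by (rule null_sets_affine_along_line[where v = "(0,0,0,0,1,0,0,0)"])
      (auto intro!: continuous_intros simp: algebra_simps)
  moreover have "{u. sin (?a2 u) - sin (?a1 u) \<noteq> 0 \<and> ?L u = 0} \<in> null_sets lborel"
    by (rule null_sets_affine_along_line[where v = "(0,0,0,0,0,1,0,0)"])
      (auto intro!: continuous_intros simp: algebra_simps)
  ultimately have "AE u in lborel. ?h1 u \<noteq> 0 \<and> ?h2 u \<noteq> 0
      \<and> (cos (?a2 u) - cos (?a1 u) \<noteq> 0 \<longrightarrow> ?L u \<noteq> 0)
      \<and> (sin (?a2 u) - sin (?a1 u) \<noteq> 0 \<longrightarrow> ?L u \<noteq> 0)"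
    by (auto dest!: AE_not_in)
  then have generic: "AE u in lebesgue. ?h1 u \<noteq> 0 \<and> ?h2 u \<noteq> 0
      \<and> (cos (?a2 u) - cos (?a1 u) \<noteq> 0 \<longrightarrow> ?L u \<noteq> 0)
      \<and> (sin (?a2 u) - sin (?a1 u) \<noteq> 0 \<longrightarrow> ?L u \<noteq> 0)"
    by (rule AE_completion)
  show ?thesis
    unfolding functionally_independent_ae_def almost_everywhere_def
    using generic
  proof (rule AE_mp, intro AE_I2 impI)
    fix u
    assume g: "?h1 u \<noteq> 0 \<and> ?h2 u \<noteq> 0
      \<and> (cos (?a2 u) - cos (?a1 u) \<noteq> 0 \<longrightarrow> ?L u \<noteq> 0)
      \<and> (sin (?a2 u) - sin (?a1 u) \<noteq> 0 \<longrightarrow> ?L u \<noteq> 0)"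
      and m: "angle_coords u \<in> cotangent_bundle"
    obtain x1 x2 a1 a2 p1 p2 h1 h2 where u: "u = (x1, x2, a1, a2, p1, p2, h1, h2)"
      by (metis prod.collapse)
    have "cos a1 \<noteq> cos a2 \<or> sin a1 \<noteq> sin a2"
      using m by (intro to_angle_neq_imp) (simp add: u cotangent_bundle_def linkage_configs_def)
    then show "let ds = map (\<lambda>f. differential f (angle_coords u)) [ham, mom1, mom2, G_integral]
        in distinct ds \<and> independent (set ds)"
      using g unfolding u by (intro differentials_independent) auto
  qed
qed

theorem proposition11p1:
  shows "(\<forall>f \<in> {ham, mom1, mom2, G_integral}. \<forall>g \<in> {ham, mom1, mom2, G_integral}.
            \<forall>m \<in> cotangent_bundle. poisson_bracket f g m = 0)
       \<and> functionally_independent_ae [ham, mom1, mom2, G_integral]"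
  using poisson_commute functionally_independent by blast

end
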